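(* Let $Ax=b$ be a linear system whose (possibly complex) $n\times n$ matrix $A$ is consistently ordered and $2$-cyclic (in the sense defined in the context), with splitting $A=D-E-F$, where $D$ is the diagonal of $A$ (assumed nonsingular) and $-E$, $-F$ are the strictly lower and strictly upper triangular parts of $A$. Let $\mathcal J=D^{-1}(E+F)=I-D^{-1}A$ be the Jacobi iteration matrix, and for a scalar $\omega$ let $\mathcal L_\omega=(D-\omega E)^{-1}(\omega F+(1-\omega)D)$ be the SOR iteration matrix. Assume there is $\tilde\mu\in\mathbb C$ with $\operatorname{Re}(\tilde\mu)\ge 0$ such that $\sigma(\mathcal J)\subseteq[-\tilde\mu,\tilde\mu]:=\{t\tilde\mu: t\in[-1,1]\}\subseteq\mathbb C$ and $\pm\tilde\mu\in\sigma(\mathcal J)$. Define $\delta=|\operatorname{Arg}(\tilde\mu-1)|$. Then, if the system is solved using SOR, the optimal relaxation parameter is $$\omega_{\rm opt}=\frac{2}{1+\sqrt{1-\tilde\mu^2}},$$ and the SOR spectral radius $\rho(\mathcal L_{\omega_{\rm opt}})=|1-\omega_{\rm opt}|$ obeys, for every $R$ with $0<|\tilde\mu-1|<R$, $$2\sqrt2\,c_R^*\sin\left(\frac{\delta}{2}+\beta_m\right)\sqrt{|1-\tilde\mu|}\;\le\;1-\rho(\mathcal L_{\omega_{\rm opt}})\;\le\;2\sqrt2\,\sin\left(\frac{\delta}{2}+\beta_M\right)\sqrt{|1-\tilde\mu|},$$ where $\beta_m$ and $\beta_M$ are the values of $\beta$ with $0\le\beta\le\frac12\arctan|\operatorname{Im}(\tilde\mu)|$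 that minimize and maximize $\sin(\frac{\delta}{2}+\beta)$, respectively, and where $c_R^*>0$ is the monotonically decreasing function of $R\ge 0$ obeying $c_0^*=1$ and given explicitly by $$c_R^*=\frac{c_R}{1+\sqrt{R(2+R)}},\qquad c_R=\begin{cases}\dfrac{1}{\sqrt2\left(\frac{1}{\sqrt{2-R}}+\sqrt R\right)} & \text{if } 0\le R\le 1,\\[3mm] \dfrac{1}{\sqrt2\left(\frac{1}{\sqrt R}+\sqrt R\right)} & \text{if } R>1.\end{cases}$$ Consequently, $\rho(\mathcal L_{\omega_{\rm opt}})<1$ if $\tilde\mu\in\{z\in\mathbb C:\operatorname{Re}(z)\ge 0\}\setminus[1,\infty)$, and $\rho(\mathcal L_{\omega_{\rm opt}})=1$ if $\tilde\mu\in[1,\infty)$.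
   Context: $\sigma(B)$ is the set of eigenvalues of a matrix $B$ and $\rho(B)=\max_{\lambda\in\sigma(B)}|\lambda|$ is its spectral radius. $\operatorname{Arg}$ is the principal argument, with values in $(-\pi,\pi]$, and $\sqrt{\cdot}$ is the principal branch of the square root (branch cut on the negative real axis). SOR for $Ax=b$ with relaxation parameter $\omega$ and initial guess $x_0$ is the iteration $x_{k+1}=\mathcal L_\omega x_k+(D-\omega E)^{-1}\omega b$, $k=0,1,\dots$. The optimal relaxation parameter is the (complex) $\omega$ for which $\rho(\mathcal L_\omega)$ is smallest. An $n\times n$ matrix $A$ is said to be a consistently ordered $2$-cyclic matrix if it can be symmetrically permuted into the block form $\begin{bmatrix} D_1 & A_{12}\\ A_{21} & D_2\end{bmatrix}$, where the matrices $D_1,D_2$ are diagonal and nonsingular.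
   Formalization: The given ordering of A is assumed consistently ordered in Young's sense (permutability to block form alone makes the claim false, e.g. a 4-cycle numbered cyclically); uniqueness of the optimal ω is claimed only for μ̃ outside [1,∞), since on [1,∞) ω=0 is also optimal. *)

theory Defs
  imports
    "HOL-Combinatorics.Permutations"
    "Jordan_Normal_Form.Gauss_Jordan_Elimination"
    "Jordan_Normal_Form.Spectral_Radius"
begin

text \<open>The splitting \<open>A = D - E - F\<close>. Note the signs of \<open>E\<close> and \<open>F\<close>.\<close>

definition diag_part :: "complex mat \<Rightarrow> complex mat" where
  "diag_part A = mat (dim_row A) (dim_col A) (\<lambda>(i,j). if i = j then A $$ (i,j) else 0)"

definition neg_lower_part :: "complex mat \<Rightarrow> complex mat" where
  "neg_lower_part A = mat (dim_row A) (dim_col A) (\<lambda>(i,j). if j < i then - A $$ (i,j) else 0)"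

definition neg_upper_part :: "complex mat \<Rightarrow> complex mat" where
  "neg_upper_part A = mat (dim_row A) (dim_col A) (\<lambda>(i,j). if i < j then - A $$ (i,j) else 0)"

lemma splitting:
  assumes "A \<in> carrier_mat n n"
  shows "A = diag_part A - neg_lower_part A - neg_upper_part A"
  by (rule eq_matI)
     (use assms in \<open>auto simp: diag_part_def neg_lower_part_def neg_upper_part_def\<close>)

text \<open>Both uses of the inverse below concern matrices that are invertible whenever the
  diagonal of \<open>A\<close> is nonsingular; \<open>the\<close> is arbitrary otherwise.\<close>

definition mat_inv :: "complex mat \<Rightarrow> complex mat" where
  "mat_inv B = the (mat_inverse B)"

definition jacobi_mat :: "complex mat \<Rightarrow> complex mat" where
  "jacobi_mat A = mat_inv (diag_part A) * (neg_lower_part A + neg_upper_part A)"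

definition sor_mat :: "complex mat \<Rightarrow> complex \<Rightarrow> complex mat" where
  "sor_mat A \<omega> =
     mat_inv (diag_part A - \<omega> \<cdot>\<^sub>m neg_lower_part A)
       * (\<omega> \<cdot>\<^sub>m neg_upper_part A + (1 - \<omega>) \<cdot>\<^sub>m diag_part A)"

text \<open>\<open>A\<close> is symmetrically permuted into the \<open>2 \<times> 2\<close> block form with diagonal nonsingular
  diagonal blocks. A block may be empty, so that diagonal matrices (including the
  \<open>1 \<times> 1\<close> case) are covered.\<close>

definition two_cyclic :: "complex mat \<Rightarrow> bool" where
  "two_cyclic A \<longleftrightarrow> (\<exists>p k m D1 A12 A21 D2.
     k + m = dim_row A \<and> dim_col A = dim_row A \<and> p permutes {..<dim_row A} \<and>
     D1 \<in> carrier_mat k k \<and> A12 \<in> carrier_mat k m \<and>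
     A21 \<in> carrier_mat m k \<and> D2 \<in> carrier_mat m m \<and>
     diagonal_mat D1 \<and> invertible_mat D1 \<and> diagonal_mat D2 \<and> invertible_mat D2 \<and>
     mat (dim_row A) (dim_row A) (\<lambda>(i,j). A $$ (p i, p j)) = four_block_mat D1 A12 A21 D2)"

text \<open>The SOR matrix depends on the order of the unknowns, and being permutable to the block
  form does not restrict that order. With only \<open>two_cyclic\<close> the relation between the spectra of
  the Jacobi and SOR matrices fails, for instance for unit diagonal and all other nonzero entries
  equal to \<open>-2/5\<close> at the edges of the 4-cycle numbered 0, 1, 2, 3 around the cycle: then
  \<open>\<mu> = 4/5\<close> and \<open>\<omega> = 5/4\<close>, but \<open>sor_mat A \<omega>\<close> has an eigenvalue strictly between
  \<open>1/4 = |1 - \<omega>|\<close> and \<open>1/2\<close>. ``Consistently ordered'' is therefore taken in the classical sense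
  of Young: the unknowns carry levels \<open>\<gamma>\<close> such that, of two coupled unknowns,
  the later one lies exactly one level above the earlier one. Every matrix that already has the
  block form satisfies this, as shown below.\<close>

definition consistently_ordered :: "complex mat \<Rightarrow> bool" where
  "consistently_ordered A \<longleftrightarrow> (\<exists>\<gamma> :: nat \<Rightarrow> int. \<forall>j < dim_row A. \<forall>i < j.
     A $$ (i,j) \<noteq> 0 \<or> A $$ (j,i) \<noteq> 0 \<longrightarrow> \<gamma> j = \<gamma> i + 1)"

lemma consistently_ordered_block_form:
  assumes "D1 \<in> carrier_mat k k" "A12 \<in> carrier_mat k m"
    and "A21 \<in> carrier_mat m k" "D2 \<in> carrier_mat m m"
    and "diagonal_mat D1" "diagonal_mat D2"
  shows "consistently_ordered (four_block_mat D1 A12 A21 D2)"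
  unfolding consistently_ordered_def
  by (rule exI[of _ "\<lambda>i. if i < k then 0 else 1"])
     (use assms in \<open>auto simp: diagonal_mat_def\<close>)

definition c_aux :: "real \<Rightarrow> real" where
  "c_aux R = (if R \<le> 1 then 1 / (sqrt 2 * (1 / sqrt (2 - R) + sqrt R))
              else 1 / (sqrt 2 * (1 / sqrt R + sqrt R)))"

definition c_star :: "real \<Rightarrow> real" where
  "c_star R = c_aux R / (1 + sqrt (R * (2 + R)))"

end

theory Submission
  imports Defs
begin

text \<open>For \<open>\<omega> \<noteq> 0\<close>, consistent ordering gives Young's relation: \<open>s\<^sup>2 \<noteq> 0\<close> is an eigenvalue of the SOR matrix
  iff \<open>s\<^sup>2 - \<omega> m s + \<omega> - 1 = 0\<close> for some Jacobi eigenvalue \<open>m\<close>. For \<open>m = \<mu>\<close> the two roots \<open>s, t\<close> satisfy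
  \<open>\<omega> = 1 + s t\<close> and \<open>s + t = \<mu> (1 + s t)\<close>. The latter is the polarization of \<open>2 z = \<mu> (1 + z\<^sup>2)\<close>,
  whose roots are \<open>s\<^sub>0 = \<mu> / (1 + q)\<close>, with \<open>q\<close> the square root of \<open>1 - \<mu>\<^sup>2\<close>, and \<open>1 / s\<^sub>0\<close>. As in
  Grace's theorem, \<open>s\<close> and \<open>t\<close> cannot both lie in the open disc of radius \<open>\<bar>s\<^sub>0\<bar> \<le> 1\<close>, which is the
  optimality of \<open>1 + s\<^sub>0\<^sup>2 = 2 / (1 + q)\<close>. At this parameter the eigenvalue \<open>m = \<tau> \<mu>\<close> gives
  \<open>s = s\<^sub>0 z\<close> with \<open>z\<^sup>2 - 2 \<tau> z + 1 = 0\<close>, so \<open>\<bar>z\<bar> = 1\<close> and every eigenvalue has modulus \<open>\<bar>s\<^sub>0\<bar>\<^sup>2\<close>.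

  The bounds come from \<open>1 - \<bar>1 - q\<bar> / \<bar>1 + q\<bar> = 4 Re q / (\<bar>1 + q\<bar> (\<bar>1 + q\<bar> + \<bar>1 - q\<bar>))\<close> together
  with \<open>Re q = \<bar>1 - \<mu>\<^sup>2\<bar>\<^sup>1\<^sup>/\<^sup>2 sin ((\<delta> + \<alpha>) / 2)\<close>, where \<open>\<alpha> = \<bar>Arg (1 + \<mu>)\<bar> \<le> arctan \<bar>Im \<mu>\<bar>\<close>.\<close>

section \<open>Spectra of the Jacobi and SOR matrices\<close>

text \<open>In the Leibniz formula the term of a permutation \<open>p\<close> gains the product of
  all \<open>c i\<close> divided by the product of all \<open>c (p i)\<close>, and reindexing shows
  this quotient to be 1.\<close>

lemma det_diagonal_similarity:
  fixes M :: "'a :: field mat"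
  assumes M: "M \<in> carrier_mat n n" and c: "\<And>i. c i \<noteq> 0"
  shows "det (mat n n (\<lambda>(i,j). c i / c j * M $$ (i,j))) = det M"
proof -
  have "(\<Prod>i = 0..<n. mat n n (\<lambda>(i,j). c i / c j * M $$ (i,j)) $$ (i, p i))
      = (\<Prod>i = 0..<n. M $$ (i, p i))" if p: "p permutes {0..<n}" for p
  proof -
    have "(\<Prod>i = 0..<n. mat n n (\<lambda>(i,j). c i / c j * M $$ (i,j)) $$ (i, p i))
        = (\<Prod>i = 0..<n. c i / c (p i) * M $$ (i, p i))"
      using permutes_in_image[OF p] by (intro prod.cong) auto
    also have "\<dots> = (\<Prod>i = 0..<n. c i) / (\<Prod>i = 0..<n. c (p i)) * (\<Prod>i = 0..<n. M $$ (i, p i))"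
      by (simp add: prod.distrib prod_dividef)
    also have "(\<Prod>i = 0..<n. c (p i)) = (\<Prod>i = 0..<n. c i)"
      using prod.permute[OF p, of c] by (simp add: o_def)
    finally show ?thesis using c by simp
  qed
  then show ?thesis
    by (subst (1 2) det_def'[of _ n]) (use M in auto)
qed

lemma mat_inv_mult:
  assumes "M \<in> carrier_mat n n" and "det M \<noteq> 0"
  shows "mat_inv M \<in> carrier_mat n n" and "M * mat_inv M = 1\<^sub>m n"
proof -
  obtain B where "mat_inverse M = Some B"
    using mat_inverse(1)[OF assms(1), where b = "()"] det_non_zero_imp_unit[OF assms, where b = "()"]
    by (cases "mat_inverse M") auto
  then show "mat_inv M \<in> carrier_mat n n" "M * mat_inv M = 1\<^sub>m n"
    using mat_inverse(2)[OF assms(1)] by (auto simp: mat_inv_def)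
qed

text \<open>Multiplying the characteristic matrix by \<open>M\<close> from the left gives
  \<open>N - e \<cdot>\<^sub>m M\<close>, so the condition becomes free of inverses. Both iteration
  matrices have this form.\<close>

lemma spectrum_mat_inv_mult:
  assumes M: "M \<in> carrier_mat n n" and d: "det M \<noteq> 0" and N: "N \<in> carrier_mat n n"
  shows "e \<in> spectrum (mat_inv M * N) \<longleftrightarrow> det (N - e \<cdot>\<^sub>m M) = 0"
proof -
  let ?L = "mat_inv M * N"
  note I = mat_inv_mult[OF M d]
  have L: "?L \<in> carrier_mat n n" using I N by auto
  have "M * char_matrix ?L e = M * ?L + M * ((-e) \<cdot>\<^sub>m 1\<^sub>m n)"
    unfolding char_matrix_def using I M N L by (subst mult_add_distrib_mat[of _ n n _ n]) auto
  also have "M * ?L = N"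
    using I M N by (subst assoc_mult_mat[symmetric, of _ n n _ n _ n]) auto
  also have "M * ((-e) \<cdot>\<^sub>m 1\<^sub>m n) = (-e) \<cdot>\<^sub>m M"
    using M by (simp add: mult_smult_distrib[of _ n n _ n])
  also have "N + (-e) \<cdot>\<^sub>m M = N - e \<cdot>\<^sub>m M"
    using M N by (intro eq_matI) auto
  finally have "det (N - e \<cdot>\<^sub>m M) = det M * det (char_matrix ?L e)"
    using M L by (metis det_mult char_matrix_closed)
  then show ?thesis
    using d eigenvalue_det[OF L] by (simp add: spectrum_def)
qed

lemma part_carrier [simp]:
  assumes "A \<in> carrier_mat n n"
  shows "diag_part A \<in> carrier_mat n n" "neg_lower_part A \<in> carrier_mat n n"
    "neg_upper_part A \<in> carrier_mat n n"
  using assms by (auto simp: diag_part_def neg_lower_part_def neg_upper_part_def)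

text \<open>Both matrices are lower triangular with the same diagonal. Hence \<open>sor_mat\<close>
  uses a true inverse for every \<omega> once \<open>diag_part A\<close> is nonsingular.\<close>

lemma det_diag_minus_lower:
  assumes A: "A \<in> carrier_mat n n"
  shows "det (diag_part A - \<omega> \<cdot>\<^sub>m neg_lower_part A) = det (diag_part A)"
proof -
  let ?M = "diag_part A - \<omega> \<cdot>\<^sub>m neg_lower_part A"
  have "det ?M = prod_list (diag_mat ?M)"
    by (rule det_lower_triangular[of n]) (use A in \<open>auto simp: diag_part_def neg_lower_part_def minus_carrier_mat\<close>)
  also have "diag_mat ?M = diag_mat (diag_part A)"
    using A by (auto simp: diag_mat_def diag_part_def neg_lower_part_def)
  also have "prod_list \<dots> = det (diag_part A)"
    by (rule det_lower_triangular[symmetric, of n]) (use A in \<open>auto simp: diag_part_def\<close>)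
  finally show ?thesis .
qed

lemma det_diag_part_nonzero:
  assumes A: "A \<in> carrier_mat n n" and inv: "invertible_mat (diag_part A)"
  shows "det (diag_part A) \<noteq> 0"
proof -
  let ?D = "diag_part A"
  obtain B where B: "?D * B = 1\<^sub>m (dim_row ?D)" "B * ?D = 1\<^sub>m (dim_row B)"
    using inv by (auto simp: invertible_mat_def inverts_mat_def)
  have "dim_row ?D = n" "dim_col ?D = n" using part_carrier(1)[OF A] by auto
  moreover from this have "dim_row B = n" "dim_col B = n"
    using B by (metis index_mult_mat(3) index_one_mat(3))+
  ultimately have "B \<in> carrier_mat n n" "?D * B = 1\<^sub>m n"
    using B by auto
  then have "det ?D * det B = 1"
    using det_mult[of ?D n B] A by simp
  then show ?thesis by auto
qed

section \<open>Consistent ordering and Young's relation\<close>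

text \<open>Conjugation with \<open>diag (x ^ \<gamma> i)\<close> multiplies the upper part by \<open>1 / x\<close> and the lower
  part by \<open>x\<close>.\<close>

lemma det_consistently_ordered:
  assumes A: "A \<in> carrier_mat n n" and co: "consistently_ordered A" and x: "x \<noteq> 0"
  shows "det (x \<cdot>\<^sub>m neg_lower_part A + (1 / x) \<cdot>\<^sub>m neg_upper_part A - z \<cdot>\<^sub>m diag_part A)
    = det (neg_lower_part A + neg_upper_part A - z \<cdot>\<^sub>m diag_part A)"
proof -
  from co A obtain \<gamma> :: "nat \<Rightarrow> int" where
    \<gamma>: "\<And>i j. i < j \<Longrightarrow> j < n \<Longrightarrow> A $$ (i,j) \<noteq> 0 \<or> A $$ (j,i) \<noteq> 0 \<Longrightarrow> \<gamma> j = \<gamma> i + 1"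
    unfolding consistently_ordered_def by auto
  let ?M = "neg_lower_part A + neg_upper_part A - z \<cdot>\<^sub>m diag_part A"
  let ?c = "\<lambda>i. x powi \<gamma> i"
  have "mat n n (\<lambda>(i,j). ?c i / ?c j * ?M $$ (i,j))
      = x \<cdot>\<^sub>m neg_lower_part A + (1 / x) \<cdot>\<^sub>m neg_upper_part A - z \<cdot>\<^sub>m diag_part A" (is "?L = ?R")
  proof (rule eq_matI)
    fix i j assume "i < dim_row ?R" "j < dim_col ?R"
    then have ij: "i < n" "j < n" using A by (auto simp: diag_part_def)
    consider "i = j" | "i < j" "A $$ (i,j) = 0" | "j < i" "A $$ (i,j) = 0"
      | "i < j" "\<gamma> j = \<gamma> i + 1" | "j < i" "\<gamma> i = \<gamma> j + 1"
      using \<gamma>[of i j] \<gamma>[of j i] ij by (metis linorder_neqE_nat)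
    then show "?L $$ (i,j) = ?R $$ (i,j)"
      by cases (use ij A x in \<open>simp_all add: diag_part_def neg_lower_part_def neg_upper_part_def
        power_int_add\<close>)
  qed (use A in \<open>auto simp: diag_part_def\<close>)
  then show ?thesis
    using det_diagonal_similarity[of ?M n ?c] A x
    by (simp add: minus_carrier_mat)
qed

lemma sor_carrier:
  assumes "A \<in> carrier_mat n n" and "det (diag_part A) \<noteq> 0"
  shows "sor_mat A \<omega> \<in> carrier_mat n n"
proof -
  have "mat_inv (diag_part A - \<omega> \<cdot>\<^sub>m neg_lower_part A) \<in> carrier_mat n n"
    using assms by (intro mat_inv_mult(1)) (auto simp: det_diag_minus_lower minus_carrier_mat)
  then show ?thesis
    using assms part_carrier[OF assms(1)] unfolding sor_mat_def by auto
qed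

text \<open>Young's relation \<open>(\<lambda> + \<omega> - 1)\<^sup>2 = \<omega>\<^sup>2 \<lambda> m\<^sup>2\<close> with \<open>\<lambda> = s\<^sup>2\<close>.\<close>

lemma sor_spectrum_iff:
  assumes A: "A \<in> carrier_mat n n" and d: "det (diag_part A) \<noteq> 0" and co: "consistently_ordered A"
    and s: "s \<noteq> 0" and \<omega>: "\<omega> \<noteq> 0"
  shows "s\<^sup>2 \<in> spectrum (sor_mat A \<omega>) \<longleftrightarrow> (s\<^sup>2 + \<omega> - 1) / (\<omega> * s) \<in> spectrum (jacobi_mat A)"
proof -
  let ?D = "diag_part A" and ?E = "neg_lower_part A" and ?F = "neg_upper_part A"
  let ?z = "(s\<^sup>2 + \<omega> - 1) / (\<omega> * s)"
  note [simp] = part_carrier[OF A]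
  \<comment> \<open>Dividing the SOR pencil by \<open>\<omega> * s\<close> leaves the weights
    \<open>s\<close> and \<open>1 / s\<close> on the lower and upper parts, which
    \<open>det_consistently_ordered\<close> removes.\<close>
  have "(\<omega> \<cdot>\<^sub>m ?F + (1 - \<omega>) \<cdot>\<^sub>m ?D) - s\<^sup>2 \<cdot>\<^sub>m (?D - \<omega> \<cdot>\<^sub>m ?E)
      = (\<omega> * s) \<cdot>\<^sub>m (s \<cdot>\<^sub>m ?E + (1 / s) \<cdot>\<^sub>m ?F - ?z \<cdot>\<^sub>m ?D)"
    by (intro eq_matI)
      (use A s \<omega> in \<open>auto simp: diag_part_def neg_lower_part_def neg_upper_part_def field_simps power2_eq_square\<close>)
  then have "det ((\<omega> \<cdot>\<^sub>m ?F + (1 - \<omega>) \<cdot>\<^sub>m ?D) - s\<^sup>2 \<cdot>\<^sub>m (?D - \<omega> \<cdot>\<^sub>m ?E)) = 0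
      \<longleftrightarrow> det (?E + ?F - ?z \<cdot>\<^sub>m ?D) = 0"
    using s \<omega> by (simp add: det_consistently_ordered[OF A co s])
  then show ?thesis
    unfolding sor_mat_def jacobi_mat_def
    by (subst (1 2) spectrum_mat_inv_mult[of _ n])
      (use d A in \<open>auto simp: det_diag_minus_lower minus_carrier_mat\<close>)
qed

section \<open>The optimal parameter\<close>

text \<open>The map \<open>z \<mapsto> 1 / (1 - z)\<close> sends the unit circle to the line of real
  part 1/2. The last term is twice the signed offset from that line, positive inside the
  disc.\<close>

lemma Re_inverse_one_minus:
  assumes "z \<noteq> 1"
  shows "2 * Re (1 / (1 - z)) = 1 + (1 - (cmod z)\<^sup>2) / (cmod (1 - z))\<^sup>2"
proof -
  have "(cmod (1 - z))\<^sup>2 \<noteq> 0" using assms by simp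
  moreover have "2 * (1 - Re z) = (cmod (1 - z))\<^sup>2 + (1 - (cmod z)\<^sup>2)"
    unfolding cmod_power2 by (simp add: power2_eq_square algebra_simps)
  moreover have "Re (1 / (1 - z)) = (1 - Re z) / (cmod (1 - z))\<^sup>2"
    by (simp add: Re_divide cmod_power2)
  ultimately show ?thesis by (simp add: field_simps)
qed

text \<open>The map \<open>z \<mapsto> (1 - z) / (w - z)\<close> sends the unit disc into a half-plane with \<open>0\<close> on its
  boundary, so it cannot take opposite values there.\<close>

lemma no_opposite_moebius_values:
  assumes eq: "(1 - u) * (w - v) + (1 - v) * (w - u) = 0"
    and ne: "u \<noteq> 1" "v \<noteq> 1" and le: "cmod u \<le> 1" "cmod v \<le> 1" "1 \<le> cmod w"
  shows "cmod u = 1 \<and> cmod w = 1"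
proof -
  \<comment> \<open>In these coordinates the hypothesis is linear: \<open>1 / (1 - w)\<close> is the
    midpoint of \<open>a\<close> and \<open>b\<close>.\<close>
  define a b where "a = 1 / (1 - u)" and "b = 1 / (1 - v)"
  have ab: "(1 - u) * a = 1" "(1 - v) * b = 1" using ne by (simp_all add: a_def b_def)
  have "2 + (w - 1) * (a + b) = ((1 - u) * a + (w - 1) * a) * ((1 - v) * b)
      + ((1 - v) * b + (w - 1) * b) * ((1 - u) * a)"
    unfolding ab by (simp add: algebra_simps)
  also have "\<dots> = a * b * ((1 - u) * (w - v) + (1 - v) * (w - u))" by (simp add: algebra_simps)
  finally have *: "2 + (w - 1) * (a + b) = 0" using eq by simp
  then have w1: "w \<noteq> 1" by auto
  have "a + b = 2 * (1 / (1 - w))" using * w1 by (simp add: field_simps)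
  then have "2 * Re a + 2 * Re b = 2 * (2 * Re (1 / (1 - w)))"
    by (metis Re_complex_of_real Re_divide_numeral complex_Re_numeral mult.assoc mult_2 plus_complex.sel(1) distrib_left)
  then have "(1 - (cmod u)\<^sup>2) / (cmod (1 - u))\<^sup>2 + (1 - (cmod v)\<^sup>2) / (cmod (1 - v))\<^sup>2
      = 2 * ((1 - (cmod w)\<^sup>2) / (cmod (1 - w))\<^sup>2)"
    unfolding a_def b_def Re_inverse_one_minus[OF ne(1)] Re_inverse_one_minus[OF ne(2)]
      Re_inverse_one_minus[OF w1] by simp
  moreover have "(1 - (cmod u)\<^sup>2) / (cmod (1 - u))\<^sup>2 \<ge> 0" "(1 - (cmod v)\<^sup>2) / (cmod (1 - v))\<^sup>2 \<ge> 0"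
    using le by (simp_all add: power_le_one)
  moreover have "(1 - (cmod w)\<^sup>2) / (cmod (1 - w))\<^sup>2 \<le> 0"
    using le by (simp add: divide_nonpos_nonneg)
  ultimately have "(1 - (cmod u)\<^sup>2) / (cmod (1 - u))\<^sup>2 = 0" "(1 - (cmod w)\<^sup>2) / (cmod (1 - w))\<^sup>2 = 0"
    by linarith+
  then have "(cmod u)\<^sup>2 = 1\<^sup>2" "(cmod w)\<^sup>2 = 1\<^sup>2" using ne w1 by simp_all
  then show ?thesis
    using power2_eq_imp_eq[of "cmod u" 1] power2_eq_imp_eq[of "cmod w" 1] by simp
qed

text \<open>Division by \<open>s\<^sub>0\<close> turns the disc into the unit disc and the roots
  \<open>s\<^sub>0\<close>, \<open>1 / s\<^sub>0\<close> of the quadratic into 1 and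
  \<open>w\<close>, so \<open>no_opposite_moebius_values\<close> applies. If
  \<open>cmod s\<^sub>0 = 1\<close>, then \<open>w\<close> lies on the unit circle and the pair need
  not collapse to \<open>s\<^sub>0\<close>.\<close>

lemma double_root_minimal:
  assumes s0: "2 * s\<^sub>0 = \<mu> * (1 + s\<^sub>0\<^sup>2)" and le1: "cmod s\<^sub>0 \<le> 1"
    and st: "s + t = \<mu> * (1 + s * t)" and le: "cmod s \<le> cmod s\<^sub>0" "cmod t \<le> cmod s\<^sub>0"
  shows "(cmod s = cmod s\<^sub>0 \<or> cmod t = cmod s\<^sub>0) \<and> (cmod s\<^sub>0 < 1 \<longrightarrow> s = s\<^sub>0 \<and> t = s\<^sub>0)"
proof (cases "s\<^sub>0 = 0")
  case True
  then show ?thesis using le by simp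
next
  case False
  then have \<mu>: "\<mu> \<noteq> 0" using s0 by auto
  define u v w where "u = s / s\<^sub>0" and "v = t / s\<^sub>0" and "w = 1 / s\<^sub>0\<^sup>2"
  have u: "s = u * s\<^sub>0" and v: "t = v * s\<^sub>0" using False by (simp_all add: u_def v_def)
  have nu: "cmod u \<le> 1" "cmod v \<le> 1" and nw: "1 \<le> cmod w"
    using le le1 False by (simp_all add: u_def v_def w_def norm_divide norm_power power_le_one)
  have "\<mu> * ((1 + s\<^sub>0\<^sup>2) * (u + v)) = 2 * s\<^sub>0 * (u + v)" by (simp add: s0)
  also have "\<dots> = 2 * (s + t)" by (simp add: u v algebra_simps)
  also have "\<dots> = \<mu> * (2 * (1 + u * v * s\<^sub>0\<^sup>2))"
    unfolding st by (simp add: u v power2_eq_square mult_ac)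
  finally have "\<mu> * ((1 + s\<^sub>0\<^sup>2) * (u + v)) = \<mu> * (2 * (1 + u * v * s\<^sub>0\<^sup>2))" .
  then have *: "(1 + s\<^sub>0\<^sup>2) * (u + v) = 2 * (1 + u * v * s\<^sub>0\<^sup>2)" using \<mu> by simp
  \<comment> \<open>The polarization of \<open>(1 - z) * (w - z) = 0\<close>, up to a factor
    2.\<close>
  have eq: "(1 - u) * (w - v) + (1 - v) * (w - u) = 0"
  proof -
    have w: "s\<^sub>0\<^sup>2 * w = 1" using False by (simp add: w_def)
    have "s\<^sub>0\<^sup>2 * ((1 - u) * (w - v) + (1 - v) * (w - u))
        = 2 * (s\<^sub>0\<^sup>2 * w) + 2 * u * v * s\<^sub>0\<^sup>2 - (s\<^sub>0\<^sup>2 + s\<^sub>0\<^sup>2 * w) * (u + v)"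
      by (simp add: algebra_simps)
    also have "\<dots> = 0" unfolding w using * by (simp add: algebra_simps)
    finally show ?thesis using False by simp
  qed
  show ?thesis
  proof (cases "u = 1 \<or> v = 1")
    case True
    then have "(1 - u) * (w - 1) = 0 \<and> v = 1 \<or> (1 - v) * (w - 1) = 0 \<and> u = 1" using eq by auto
    then have "u = 1 \<and> v = 1 \<or> w = 1 \<and> (u = 1 \<or> v = 1)" by auto
    moreover have "cmod s\<^sub>0 = 1" if "w = 1"
      using that False by (auto simp: w_def power2_eq_1_iff)
    ultimately show ?thesis using u v by auto
  next
    case F: False
    then have "cmod u = 1" "cmod w = 1"
      using no_opposite_moebius_values[OF eq _ _ nu nw] by auto
    moreover from this have "cmod s\<^sub>0 = 1"
      using False power2_eq_imp_eq[of "cmod s\<^sub>0" 1] by (simp add: w_def norm_divide norm_power)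
    ultimately show ?thesis by (simp add: u norm_mult)
  qed
qed

section \<open>Spectral radius of the SOR matrix\<close>

text \<open>The roots have real part \<open>t\<close> and imaginary part plus or minus
  \<open>sqrt (1 - t\<^sup>2)\<close>.\<close>

lemma norm_root_palindromic:
  assumes eq: "z\<^sup>2 + 1 = 2 * complex_of_real t * z" and t: "t \<in> {-1..1}"
  shows "cmod z = 1"
proof -
  obtain x y where z: "z = Complex x y" by (cases z)
  have re: "x\<^sup>2 - y\<^sup>2 + 1 = 2 * t * x" and im: "y * (x - t) = 0"
    using arg_cong[OF eq, of Re] arg_cong[OF eq, of Im]
    by (auto simp: z power2_eq_square algebra_simps)
  have "x\<^sup>2 + y\<^sup>2 = 1"
  proof (cases "y = 0")
    case True
    have "(x - t)\<^sup>2 + (1 - t\<^sup>2) = 0" using re True by (simp add: power2_eq_square algebra_simps)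
    moreover have "t\<^sup>2 \<le> 1" using t by (simp add: abs_square_le_1 abs_le_iff)
    ultimately have "(x - t)\<^sup>2 = 0" "t\<^sup>2 = 1" using zero_le_power2[of "x - t"] by linarith+
    then show ?thesis using True by simp
  next
    case False
    then show ?thesis using re im by (simp add: power2_eq_square algebra_simps)
  qed
  then show ?thesis by (simp add: z cmod_def)
qed

text \<open>For nonzero \<omega> take the roots of
  \<open>x\<^sup>2 - \<omega> * \<mu> * x + \<omega> - 1\<close>. By Young's relation the square of
  a nonzero root is an SOR eigenvalue; for a zero root the bound is trivial.\<close>

lemma sor_root_pair:
  assumes A: "A \<in> carrier_mat n n" and n: "n > 0" and d: "det (diag_part A) \<noteq> 0"
    and co: "consistently_ordered A" and \<mu>: "\<mu> \<in> spectrum (jacobi_mat A)"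
  obtains s t where "s + t = \<mu> * (1 + s * t)" "\<omega> = 1 + s * t"
    "(cmod s)\<^sup>2 \<le> spectral_radius (sor_mat A \<omega>)" "(cmod t)\<^sup>2 \<le> spectral_radius (sor_mat A \<omega>)"
proof -
  note L = sor_carrier[OF A d, of \<omega>]
  have le: "cmod l \<le> spectral_radius (sor_mat A \<omega>)" if "l \<in> spectrum (sor_mat A \<omega>)" for l
    using spectral_radius_mem_max(2)[OF L n] that by auto
  have nonneg: "0 \<le> spectral_radius (sor_mat A \<omega>)"
    using spectral_radius_mem_max(1)[OF L n] by auto
  show thesis
  proof (cases "\<omega> = 0")
    \<comment> \<open>Young's relation needs nonzero \<omega>. Here the SOR matrix is the identity,
      so 1 is an eigenvalue, and \<open>s = 1\<close>, \<open>t = -1\<close> solve both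
      equations.\<close>
    case True
    let ?M = "diag_part A - 0 \<cdot>\<^sub>m neg_lower_part A"
      and ?N = "0 \<cdot>\<^sub>m neg_upper_part A + (1 - 0) \<cdot>\<^sub>m diag_part A"
    have "?N - 1 \<cdot>\<^sub>m ?M = 0\<^sub>m n n"
      using A by (intro eq_matI) (auto simp: diag_part_def neg_lower_part_def neg_upper_part_def)
    then have "det (?N - 1 \<cdot>\<^sub>m ?M) = 0" using n by (simp add: det_zero)
    then have "1 \<in> spectrum (sor_mat A 0)"
      unfolding sor_mat_def
      by (subst spectrum_mat_inv_mult[of _ n]) (use d A in \<open>auto simp: det_diag_minus_lower minus_carrier_mat\<close>)
    then have "1 \<le> spectral_radius (sor_mat A \<omega>)" using le[of 1] True by simp
    then show thesis using that[of 1 "-1"] True by simp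
  next
    case False
    define r where "r = csqrt ((\<omega> * \<mu>)\<^sup>2 - 4 * (\<omega> - 1))"
    define s t where "s = (\<omega> * \<mu> + r) / 2" and "t = (\<omega> * \<mu> - r) / 2"
    have sum: "s + t = \<omega> * \<mu>" by (simp add: s_def t_def field_simps)
    have "s * t = ((\<omega> * \<mu>)\<^sup>2 - r\<^sup>2) / 4" by (simp add: s_def t_def power2_eq_square field_simps)
    also have "\<dots> = \<omega> - 1" by (simp add: r_def del: right_diff_distrib_numeral)
    finally have prod: "s * t = \<omega> - 1" .
    have "(cmod x)\<^sup>2 \<le> spectral_radius (sor_mat A \<omega>)" if x: "x * (\<omega> * \<mu> - x) = \<omega> - 1" for x
    proof (cases "x = 0")
      case True
      then show ?thesis using nonneg by simp
    next
      case x0: False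
      have "x\<^sup>2 + \<omega> - 1 = \<mu> * (\<omega> * x)" using x by (simp add: power2_eq_square algebra_simps)
      then have "(x\<^sup>2 + \<omega> - 1) / (\<omega> * x) = \<mu>" using x0 False by simp
      then have "x\<^sup>2 \<in> spectrum (sor_mat A \<omega>)"
        using sor_spectrum_iff[OF A d co x0 False] \<mu> by simp
      then show ?thesis using le by (fastforce simp: norm_power)
    qed
    moreover have "s * (\<omega> * \<mu> - s) = \<omega> - 1" "t * (\<omega> * \<mu> - t) = \<omega> - 1"
      unfolding sum[symmetric] using prod by (simp_all add: mult.commute)
    moreover have "s + t = \<mu> * (1 + s * t)" "\<omega> = 1 + s * t" unfolding sum prod by simp_all
    ultimately show thesis using that[of s t] by blast
  qed
qed

lemma spectral_radius_sor_opt: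
  assumes A: "A \<in> carrier_mat n n" and n: "n > 0" and d: "det (diag_part A) \<noteq> 0"
    and co: "consistently_ordered A" and \<mu>: "\<mu> \<in> spectrum (jacobi_mat A)"
    and sub: "spectrum (jacobi_mat A) \<subseteq> {complex_of_real t * \<mu> | t. t \<in> {-1..1}}"
    and s0: "2 * s\<^sub>0 = \<mu> * (1 + s\<^sub>0\<^sup>2)" and ne: "1 + s\<^sub>0\<^sup>2 \<noteq> 0"
  shows "spectral_radius (sor_mat A (1 + s\<^sub>0\<^sup>2)) = (cmod s\<^sub>0)\<^sup>2"
proof (rule antisym)
  let ?L = "sor_mat A (1 + s\<^sub>0\<^sup>2)"
  note L = sor_carrier[OF A d, of "1 + s\<^sub>0\<^sup>2"]
  obtain l where l: "l \<in> spectrum ?L" "spectral_radius ?L = cmod l"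
    using spectral_radius_mem_max(1)[OF L n] by auto
  have "cmod l \<le> (cmod s\<^sub>0)\<^sup>2"
  proof (cases "l = 0")
    case False
    define s where "s = csqrt l"
    have s: "s \<noteq> 0" "s\<^sup>2 = l" using False by (simp_all add: s_def)
    then obtain t where t: "(s\<^sup>2 + (1 + s\<^sub>0\<^sup>2) - 1) / ((1 + s\<^sub>0\<^sup>2) * s) = of_real t * \<mu>" "t \<in> {-1..1}"
      using sor_spectrum_iff[OF A d co s(1) ne] l sub by auto
    have "s\<^sup>2 + s\<^sub>0\<^sup>2 = (s\<^sup>2 + (1 + s\<^sub>0\<^sup>2) - 1) / ((1 + s\<^sub>0\<^sup>2) * s) * ((1 + s\<^sub>0\<^sup>2) * s)"
      using s ne by simp
    also have "\<dots> = of_real t * s * (\<mu> * (1 + s\<^sub>0\<^sup>2))" unfolding t by (simp add: mult_ac)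
    finally have eq: "s\<^sup>2 + s\<^sub>0\<^sup>2 = 2 * of_real t * s * s\<^sub>0" by (simp flip: s0)
    then have s0': "s\<^sub>0 \<noteq> 0" using s by auto
    have "(s / s\<^sub>0)\<^sup>2 + 1 = 2 * of_real t * (s / s\<^sub>0)"
      using eq s0' by (simp add: field_simps power2_eq_square)
    then have "cmod (s / s\<^sub>0) = 1" using norm_root_palindromic t by blast
    then have "cmod s = cmod s\<^sub>0" using s0' by (simp add: norm_divide)
    then show ?thesis unfolding s(2)[symmetric] norm_power by simp
  qed simp
  then show "spectral_radius ?L \<le> (cmod s\<^sub>0)\<^sup>2" using l by simp
  \<comment> \<open>The lower bound comes from the roots belonging to \<mu> itself: their product is
    \<open>s\<^sub>0\<^sup>2\<close>, so they cannot both be smaller than \<open>s\<^sub>0\<close>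
    in modulus.\<close>
  obtain s t where st: "1 + s\<^sub>0\<^sup>2 = 1 + s * t"
    "(cmod s)\<^sup>2 \<le> spectral_radius ?L" "(cmod t)\<^sup>2 \<le> spectral_radius ?L"
    using sor_root_pair[OF A n d co \<mu>, of "1 + s\<^sub>0\<^sup>2"] by blast
  have "(cmod s\<^sub>0)\<^sup>2 = cmod s * cmod t" using st by (metis add_left_cancel norm_mult norm_power)
  also have "\<dots> \<le> ((cmod s)\<^sup>2 + (cmod t)\<^sup>2) / 2"
    using sum_squares_bound[of "cmod s" "cmod t"] by simp
  also have "\<dots> \<le> (spectral_radius ?L + spectral_radius ?L) / 2"
    using st(2,3) by (intro divide_right_mono add_mono) auto
  finally show "(cmod s\<^sub>0)\<^sup>2 \<le> spectral_radius ?L" by simp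
qed

section \<open>Bounds on the spectral radius\<close>

text \<open>The branches merge because \<open>2 - R\<close> and \<open>R\<close> exchange their
  order at 1. With \<open>R = cmod (\<mu> - 1)\<close> and \<open>Re \<mu> \<ge> 0\<close> the
  maximum is a lower bound for \<open>cmod (1 + \<mu>)\<close>.\<close>

lemma c_aux_eq:
  "c_aux R = 1 / (sqrt 2 * (1 / sqrt (max (2 - R) R) + sqrt R))"
  by (simp add: c_aux_def max_def)

text \<open>Up to 1 both summands increase; beyond 1 the sum is \<open>1 / a + a\<close> with
  \<open>a = sqrt x\<close> at least 1. The ranges are glued at 1.\<close>

lemma c_aux_denominator_mono:
  assumes "0 \<le> x" "x \<le> y"
  shows "1 / sqrt (max (2 - x) x) + sqrt x \<le> 1 / sqrt (max (2 - y) y) + sqrt y" (is "?h x \<le> ?h y")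
proof -
  have low: "?h x \<le> ?h y" if "0 \<le> x" "x \<le> y" "y \<le> 1" for x y
  proof -
    have "max (2 - x) x = 2 - x" "max (2 - y) y = 2 - y" using that by auto
    moreover have "1 / sqrt (2 - x) \<le> 1 / sqrt (2 - y)"
      using that by (intro divide_left_mono) auto
    ultimately show ?thesis using that by (simp only:) (intro add_mono real_sqrt_le_mono)
  qed
  have high: "?h x \<le> ?h y" if "1 \<le> x" "x \<le> y" for x y
  proof -
    define a b where "a = sqrt x" and "b = sqrt y"
    have ab: "1 \<le> a" "a \<le> b" using that by (simp_all add: a_def b_def)
    have "1 * 1 \<le> a * b" using ab by (intro mult_mono) auto
    then have "0 \<le> (b - a) * (a * b - 1) / (a * b)" using ab by simp
    also have "\<dots> = 1 / b + b - (1 / a + a)" using ab by (simp add: field_simps)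
    finally have "1 / a + a \<le> 1 / b + b" by simp
    moreover have "max (2 - x) x = x" "max (2 - y) y = y" using that by auto
    ultimately show ?thesis by (simp add: a_def b_def)
  qed
  show ?thesis
  proof (cases "y \<le> 1")
    case True
    then show ?thesis using low assms by blast
  next
    case y: False
    show ?thesis
    proof (cases "x \<le> 1")
      case True
      then show ?thesis using low[of x 1] high[of 1 y] y assms by linarith
    next
      case False
      then show ?thesis using high[of x y] assms by simp
    qed
  qed
qed

lemma c_aux_denominator_pos: "0 \<le> x \<Longrightarrow> 0 < 1 / sqrt (max (2 - x) x) + sqrt (x :: real)"
  by (intro add_pos_nonneg) (auto simp: max_def)

lemma c_aux_pos: "0 \<le> R \<Longrightarrow> 0 < c_aux R"
  unfolding c_aux_eq using c_aux_denominator_pos[of R] by simp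

lemma c_aux_antimono: "0 \<le> x \<Longrightarrow> x \<le> y \<Longrightarrow> c_aux y \<le> c_aux x"
  unfolding c_aux_eq
  using c_aux_denominator_mono[of x y] c_aux_denominator_pos[of x]
  by (intro divide_left_mono mult_left_mono mult_pos_pos) auto

lemma c_star_pos: "0 \<le> R \<Longrightarrow> 0 < c_star R"
  unfolding c_star_def using c_aux_pos[of R] by (intro divide_pos_pos add_pos_nonneg) auto

lemma c_star_strict_antimono: "strict_antimono_on {0..} c_star"
proof (rule monotone_onI)
  fix x y :: real assume "x \<in> {0..}" "y \<in> {0..}" and xy: "x < y"
  then have x: "0 \<le> x" by simp
  define f where "f z = 1 + sqrt (z * (2 + z))" for z :: real
  have f: "0 < f x" "f x < f y" using x xy by (auto simp: f_def intro!: add_pos_nonneg mult_strict_mono')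
  have "c_star y = c_aux y / f y" by (simp add: c_star_def f_def)
  also have "\<dots> \<le> c_aux x / f y"
    using c_aux_antimono[of x y] x xy f by (intro divide_right_mono) auto
  also have "\<dots> < c_aux x / f x" using c_aux_pos[OF x] f by (intro divide_strict_left_mono) auto
  also have "\<dots> = c_star x" by (simp add: c_star_def f_def)
  finally show "c_star x > c_star y" .
qed

lemma c_star_0: "c_star 0 = 1"
  by (simp add: c_star_def c_aux_def)

section \<open>The half angle of the square root\<close>

text \<open>Factor \<open>1 - \<mu>\<^sup>2\<close> as minus
  \<open>(\<mu> - 1) * (1 + \<mu>)\<close>. The factors have the same imaginary part, so their
  unsigned arguments add. The principal root of \<open>z\<close> has real part
  \<open>sqrt ((cmod z + Re z) / 2)\<close>, and the half-angle formula turns this into a sine. The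
  last two claims make \<open>\<alpha> / 2\<close> an admissible \<beta>.\<close>

lemma Re_csqrt_half_angle:
  fixes \<mu> :: complex
  assumes re: "Re \<mu> \<ge> 0" and ne: "\<mu> \<noteq> 1"
  defines "\<alpha> \<equiv> arctan (\<bar>Im \<mu>\<bar> / (1 + Re \<mu>))"
  shows "Re (csqrt (1 - \<mu>\<^sup>2)) = sqrt (cmod (\<mu> - 1) * cmod (1 + \<mu>)) * sin (\<bar>Arg (\<mu> - 1)\<bar> / 2 + \<alpha> / 2)"
    and "0 \<le> sin (\<bar>Arg (\<mu> - 1)\<bar> / 2 + \<alpha> / 2)"
    and "\<alpha> \<ge> 0" "\<alpha> \<le> arctan \<bar>Im \<mu>\<bar>"
proof -
  define \<delta> where "\<delta> = \<bar>Arg (\<mu> - 1)\<bar>"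
  define x y d P where "x = Re \<mu>" and "y = \<bar>Im \<mu>\<bar>" and "d = cmod (\<mu> - 1)" and "P = cmod (1 + \<mu>)"
  have d: "d > 0" using ne by (simp add: d_def)
  have xy: "x \<ge> 0" "y \<ge> 0" using re by (simp_all add: x_def y_def)
  have P: "P = sqrt ((1 + x)\<^sup>2 + y\<^sup>2)" by (simp add: P_def cmod_def x_def y_def)
  have P0: "P > 0" using xy by (auto simp: P intro!: add_pos_nonneg)
  show a0: "\<alpha> \<ge> 0" using re by (simp add: \<alpha>_def)
  have "\<bar>Im \<mu>\<bar> / (1 + Re \<mu>) \<le> \<bar>Im \<mu>\<bar> / 1" using re by (intro divide_left_mono) auto
  then show "\<alpha> \<le> arctan \<bar>Im \<mu>\<bar>" by (simp add: \<alpha>_def arctan_monotone')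
  have \<alpha>: "\<alpha> = arctan (y / (1 + x))" by (simp add: \<alpha>_def x_def y_def)
  have "1 + (y / (1 + x))\<^sup>2 = (P / (1 + x))\<^sup>2"
    using xy by (simp add: P power_divide field_simps)
  then have sq: "sqrt (1 + (y / (1 + x))\<^sup>2) = P / (1 + x)" using xy P0 by simp
  have cosa: "P * cos \<alpha> = 1 + x" and sina: "P * sin \<alpha> = y"
    unfolding \<alpha> cos_arctan sin_arctan sq using xy P0 by simp_all
  have ne1: "\<mu> - 1 \<noteq> 0" using ne by simp
  have cosd: "d * cos \<delta> = x - 1"
    using cos_Arg[OF ne1] d by (simp add: \<delta>_def d_def x_def)
  have bd: "0 \<le> \<delta>" "\<delta> \<le> pi" using Arg_bounded[of "\<mu> - 1"] by (auto simp: \<delta>_def)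
  \<comment> \<open>As \<delta> lies between 0 and \<open>pi\<close>, its sine is nonnegative and
    encodes \<open>\<bar>Im \<mu>\<bar>\<close>.\<close>
  have "sin \<delta> = \<bar>sin (Arg (\<mu> - 1))\<bar>"
    using sin_ge_zero[OF bd] by (auto simp: \<delta>_def abs_if split: if_splits)
  then have sind: "d * sin \<delta> = y"
    using sin_Arg[OF ne1] d by (simp add: d_def y_def abs_divide)
  have "d * P * cos (\<delta> + \<alpha>) = (d * cos \<delta>) * (P * cos \<alpha>) - (d * sin \<delta>) * (P * sin \<alpha>)"
    by (simp add: cos_add algebra_simps)
  also have "\<dots> = - Re (1 - \<mu>\<^sup>2)"
    unfolding cosa sina cosd sind by (simp add: x_def y_def power2_eq_square algebra_simps)
  finally have Rez: "Re (1 - \<mu>\<^sup>2) = - (d * P * cos (\<delta> + \<alpha>))" by simp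
  have "1 - \<mu>\<^sup>2 = - ((\<mu> - 1) * (1 + \<mu>))" by (simp add: power2_eq_square algebra_simps)
  then have cmz: "cmod (1 - \<mu>\<^sup>2) = d * P" by (metis norm_minus_cancel norm_mult d_def P_def)
  have "\<alpha> < pi / 2" unfolding \<alpha>_def by (rule arctan_ubound)
  then show S: "0 \<le> sin (\<bar>Arg (\<mu> - 1)\<bar> / 2 + \<alpha> / 2)"
    using a0 bd unfolding \<delta>_def by (intro sin_ge_zero) linarith+
  have "cos (\<delta> + \<alpha>) = 1 - 2 * (sin (\<delta> / 2 + \<alpha> / 2))\<^sup>2"
    using cos_double_sin[of "\<delta> / 2 + \<alpha> / 2"] by (simp add: algebra_simps)
  then have "(cmod (1 - \<mu>\<^sup>2) + Re (1 - \<mu>\<^sup>2)) / 2 = d * P * (sin (\<delta> / 2 + \<alpha> / 2))\<^sup>2"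
    unfolding cmz Rez by (simp only:) (simp add: algebra_simps)
  then have "Re (csqrt (1 - \<mu>\<^sup>2)) = sqrt (d * P * (sin (\<delta> / 2 + \<alpha> / 2))\<^sup>2)"
    by simp
  also have "\<dots> = sqrt (d * P) * sin (\<delta> / 2 + \<alpha> / 2)"
    using S by (simp add: real_sqrt_mult \<delta>_def)
  finally show "Re (csqrt (1 - \<mu>\<^sup>2)) = sqrt (cmod (\<mu> - 1) * cmod (1 + \<mu>)) * sin (\<bar>Arg (\<mu> - 1)\<bar> / 2 + \<alpha> / 2)"
    by (simp add: d_def P_def \<delta>_def)
qed

section \<open>Estimates for the gap between the radius and 1\<close>

text \<open>The squares of \<open>cmod (1 + q)\<close> and \<open>cmod (1 - q)\<close> differ by
  \<open>4 * Re q\<close>.\<close>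

lemma one_minus_norm_ratio:
  assumes "Re q \<ge> 0"
  shows "1 - cmod (1 - q) / cmod (1 + q)
    = 4 * Re q / (cmod (1 + q) * (cmod (1 + q) + cmod (1 - q)))"
proof -
  define a b where "a = cmod (1 + q)" and "b = cmod (1 - q)"
  have "a > 0" using assms by (auto simp: a_def complex_eq_iff)
  moreover have "b \<ge> 0" by (simp add: b_def)
  moreover have "a\<^sup>2 - b\<^sup>2 = 4 * Re q"
    unfolding a_def b_def cmod_power2 by (simp add: power2_eq_square algebra_simps)
  moreover have "1 - b / a = (a\<^sup>2 - b\<^sup>2) / (a * (a + b))"
    using calculation(1,2) by (simp add: divide_simps) (simp add: power2_eq_square algebra_simps)
  ultimately show ?thesis by (simp add: a_def b_def)
qed

context
  fixes \<mu> q :: complex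
  assumes re: "Re \<mu> \<ge> 0" "Re q \<ge> 0" and q: "q\<^sup>2 = 1 - \<mu>\<^sup>2"
begin

text \<open>The right side \<open>X\<close> is the square of \<open>cmod (1 + q)\<close> plus the
  square of \<open>m = cmod \<mu>\<close>. Hence \<open>X\<close> is at least 2 and at least
  \<open>1 + m\<^sup>2\<close>, which yields
  \<open>X\<^sup>2 \<ge> 2 * X \<ge> 2 * (1 + m)\<close>.\<close>

lemma norm_product_bound_below:
  "sqrt 2 * sqrt (cmod (1 + \<mu>)) \<le> cmod (1 + q) * (cmod (1 + q) + cmod (1 - q))"
proof -
  define X m where "X = cmod (1 + q) * (cmod (1 + q) + cmod (1 - q))" and "m = cmod \<mu>"
  have "cmod (1 + q) * cmod (1 - q) = cmod (1 - q\<^sup>2)"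
    by (simp flip: norm_mult add: power2_eq_square algebra_simps)
  then have ab: "cmod (1 + q) * cmod (1 - q) = m\<^sup>2" by (simp add: q m_def norm_power)
  have "(cmod (1 + q))\<^sup>2 = 1 + 2 * Re q + (cmod q)\<^sup>2"
    unfolding cmod_power2 by (simp add: power2_eq_square algebra_simps)
  moreover have "(cmod q)\<^sup>2 = cmod (1 - \<mu>\<^sup>2)" by (simp flip: norm_power add: q)
  moreover have "X = (cmod (1 + q))\<^sup>2 + cmod (1 + q) * cmod (1 - q)"
    by (simp add: X_def power2_eq_square algebra_simps)
  ultimately have "X \<ge> 1 + cmod (1 - \<mu>\<^sup>2) + m\<^sup>2" using ab re by simp
  moreover have "cmod (1 - \<mu>\<^sup>2) \<ge> 1 - m\<^sup>2"
    using norm_triangle_ineq2[of 1 "\<mu>\<^sup>2"] by (simp add: m_def norm_power)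
  ultimately have X: "X \<ge> 2" "X \<ge> 1 + m\<^sup>2" using norm_ge_zero[of "1 - \<mu>\<^sup>2"] by linarith+
  have "0 \<le> (m - 1)\<^sup>2" by simp
  then have "1 + m\<^sup>2 \<ge> 2 * m" by (simp add: power2_eq_square algebra_simps)
  then have "1 + m \<le> X" using X by linarith
  moreover have "cmod (1 + \<mu>) \<le> 1 + m" using norm_triangle_ineq[of 1 \<mu>] by (simp add: m_def)
  moreover have "2 * X \<le> X * X" using X by (intro mult_right_mono) auto
  ultimately have "2 * cmod (1 + \<mu>) \<le> X\<^sup>2" by (simp add: power2_eq_square)
  then have "sqrt (2 * cmod (1 + \<mu>)) \<le> X" using X by (simp add: real_le_lsqrt)
  then show ?thesis by (simp add: real_sqrt_mult X_def)
qed

text \<open>This is where \<open>c_star\<close> originates: the first factor is at most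
  \<open>f\<close>, the sum is at most \<open>2 * h * sqrt P\<close>, and \<open>c_star d\<close> is
  the reciprocal of \<open>sqrt 2 * h * f\<close>.\<close>

lemma norm_product_bound_above:
  "c_star (cmod (\<mu> - 1)) * (cmod (1 + q) * (cmod (1 + q) + cmod (1 - q))) \<le> sqrt 2 * sqrt (cmod (1 + \<mu>))"
proof -
  define d P where "d = cmod (\<mu> - 1)" and "P = cmod (1 + \<mu>)"
  define h where "h = 1 / sqrt (max (2 - d) d) + sqrt d"
  define f where "f = 1 + sqrt (d * (2 + d))"
  have d: "d \<ge> 0" by (simp add: d_def)
  \<comment> \<open>In the right half-plane \<mu> is no farther from 1 than from -1, and these two
    points have distance 2.\<close>
  have "cmod (\<mu> - 1) \<le> cmod (1 + \<mu>)"
    unfolding cmod_def using re by (intro real_sqrt_le_mono) (simp add: power2_eq_square algebra_simps)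
  moreover have "2 \<le> cmod (1 + \<mu>) + cmod (\<mu> - 1)"
    using norm_triangle_ineq4[of "1 + \<mu>" "\<mu> - 1"] by simp
  ultimately have P: "max (2 - d) d \<le> P" by (simp add: d_def P_def)
  have m: "max (2 - d) d > 0" by (simp add: max_def)
  have P0: "P > 0" using P m by linarith
  have h: "h > 0" unfolding h_def by (rule c_aux_denominator_pos[OF d])
  have P2: "P \<le> 2 + d" using norm_triangle_ineq[of 2 "\<mu> - 1"] by (simp add: d_def P_def)
  have "q\<^sup>2 = - ((\<mu> - 1) * (1 + \<mu>))" unfolding q by (simp add: power2_eq_square algebra_simps)
  then have "(cmod q)\<^sup>2 = d * P" by (metis norm_minus_cancel norm_mult norm_power d_def P_def)
  then have nq: "cmod q = sqrt (d * P)" by (metis norm_ge_zero real_sqrt_unique)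
  have a: "cmod (1 + q) \<le> f"
  proof -
    have "cmod (1 + q) \<le> 1 + cmod q" using norm_triangle_ineq[of 1 q] by simp
    also have "cmod q \<le> sqrt (d * (2 + d))"
      unfolding nq using P2 d by (intro real_sqrt_le_mono mult_left_mono) auto
    finally show ?thesis by (simp add: f_def)
  qed
  have "cmod (1 + q) + cmod (1 - q) \<le> 2 * (1 + cmod q)"
    using norm_triangle_ineq[of 1 q] norm_triangle_ineq4[of 1 q] by simp
  also have "1 + cmod q = (1 / sqrt P + sqrt d) * sqrt P"
    using P0 by (simp add: nq real_sqrt_mult field_simps)
  also have "\<dots> \<le> h * sqrt P"
    unfolding h_def using P m P0 by (intro mult_right_mono add_right_mono divide_left_mono) auto
  finally have ab: "cmod (1 + q) + cmod (1 - q) \<le> 2 * h * sqrt P" by simp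
  have f: "f > 0" unfolding f_def using d by (intro add_pos_nonneg) auto
  have "c_star d = 1 / (sqrt 2 * h * f)" by (simp add: c_star_def c_aux_eq h_def f_def)
  moreover have "cmod (1 + q) * (cmod (1 + q) + cmod (1 - q)) \<le> f * (2 * h * sqrt P)"
    using a ab f by (intro mult_mono) auto
  ultimately have "c_star d * (cmod (1 + q) * (cmod (1 + q) + cmod (1 - q)))
      \<le> 1 / (sqrt 2 * h * f) * (f * (2 * h * sqrt P))"
    using h f by (simp only:) (intro mult_left_mono, auto)
  also have "\<dots> = sqrt 2 * sqrt P"
    using h f by (simp add: field_simps)
  finally show ?thesis by (simp add: d_def P_def)
qed

end

text \<open>The gap equals \<open>2 * S * sqrt d\<close> times \<open>2 * sP / X\<close>, and the
  two bounds on \<open>X\<close> place the latter between \<open>sqrt 2 * c_star d\<close> and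
  \<open>sqrt 2\<close>. Antitonicity of \<open>c_star\<close> later replaces \<open>d\<close> by
  any larger \<open>R\<close>.\<close>

lemma sor_radius_bounds:
  fixes \<mu> :: complex
  defines "q \<equiv> csqrt (1 - \<mu>\<^sup>2)" and "S \<equiv> sin (\<bar>Arg (\<mu> - 1)\<bar> / 2 + arctan (\<bar>Im \<mu>\<bar> / (1 + Re \<mu>)) / 2)"
  assumes re: "Re \<mu> \<ge> 0" and ne: "\<mu> \<noteq> 1"
  shows "2 * sqrt 2 * c_star (cmod (\<mu> - 1)) * S * sqrt (cmod (\<mu> - 1)) \<le> 1 - cmod (1 - q) / cmod (1 + q)"
    and "1 - cmod (1 - q) / cmod (1 + q) \<le> 2 * sqrt 2 * S * sqrt (cmod (\<mu> - 1))"
proof -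
  define X where "X = cmod (1 + q) * (cmod (1 + q) + cmod (1 - q))"
  define d sP where "d = cmod (\<mu> - 1)" and "sP = sqrt (cmod (1 + \<mu>))"
  have q: "Re q \<ge> 0" "q\<^sup>2 = 1 - \<mu>\<^sup>2" by (simp_all add: q_def Re_csqrt del: csqrt.simps)
  have S: "S \<ge> 0" and Req: "Re q = sqrt d * sP * S"
    using Re_csqrt_half_angle[OF re ne] by (simp_all add: q_def S_def d_def sP_def real_sqrt_mult)
  have "cmod (1 + q) > 0" using q(1) by (auto simp: complex_eq_iff)
  then have X: "X > 0" unfolding X_def by (intro mult_pos_pos add_pos_nonneg) auto
  have eq: "1 - cmod (1 - q) / cmod (1 + q) = 2 * S * sqrt d * (2 * sP / X)"
    unfolding one_minus_norm_ratio[OF q(1)] Req X_def by simp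
  have low: "sqrt 2 * sP \<le> X" and high: "c_star d * X \<le> sqrt 2 * sP"
    using norm_product_bound_below[OF re q] norm_product_bound_above[OF re q] by (simp_all add: X_def d_def sP_def)
  have pos: "0 \<le> 2 * S * sqrt d" using S by (simp add: d_def)
  have 2: "2 * sP = sqrt 2 * (sqrt 2 * sP)" by simp
  have "sqrt 2 * c_star d \<le> 2 * sP / X"
    using mult_left_mono[OF high, of "sqrt 2"] X unfolding 2 by (simp add: pos_le_divide_eq mult.assoc)
  from mult_left_mono[OF this pos]
  show "2 * sqrt 2 * c_star (cmod (\<mu> - 1)) * S * sqrt (cmod (\<mu> - 1)) \<le> 1 - cmod (1 - q) / cmod (1 + q)"
    unfolding eq by (simp add: d_def mult_ac)
  have "2 * sP / X \<le> sqrt 2"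
    using mult_left_mono[OF low, of "sqrt 2"] X unfolding 2 by (simp add: pos_divide_le_eq)
  from mult_left_mono[OF this pos]
  show "1 - cmod (1 - q) / cmod (1 + q) \<le> 2 * sqrt 2 * S * sqrt (cmod (\<mu> - 1))"
    unfolding eq by (simp add: d_def mult_ac)
qed

text \<open>The root is purely imaginary iff \<open>1 - \<mu>\<^sup>2\<close> is a nonpositive real.
  This separates radius 1 from radius below 1.\<close>

lemma Re_csqrt_one_minus_square_eq_0_iff:
  assumes "Re \<mu> \<ge> 0"
  shows "Re (csqrt (1 - \<mu>\<^sup>2)) = 0 \<longleftrightarrow> \<mu> \<in> complex_of_real ` {1..}"
proof
  define q where "q = csqrt (1 - \<mu>\<^sup>2)"
  assume "Re (csqrt (1 - \<mu>\<^sup>2)) = 0"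
  then have q: "Re q = 0" by (simp only: q_def)
  have "1 - \<mu>\<^sup>2 = q\<^sup>2" by (simp add: q_def)
  then have "1 - (Re \<mu>)\<^sup>2 + (Im \<mu>)\<^sup>2 = - (Im q)\<^sup>2" "Re \<mu> * Im \<mu> = 0"
    using q by (auto simp: complex_eq_iff power2_eq_square)
  then have ge: "(Re \<mu>)\<^sup>2 \<ge> 1 + (Im \<mu>)\<^sup>2" "Re \<mu> * Im \<mu> = 0"
    using zero_le_power2[of "Im q"] by linarith+
  have "(Re \<mu>)\<^sup>2 \<ge> 1" using ge(1) zero_le_power2[of "Im \<mu>"] by linarith
  moreover from this have "Re \<mu> \<noteq> 0" by auto
  ultimately have "Im \<mu> = 0" "1\<^sup>2 \<le> (Re \<mu>)\<^sup>2" using ge by auto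
  then have "\<mu> = complex_of_real (Re \<mu>)" "1 \<le> Re \<mu>"
    using assms by (auto simp: complex_eq_iff intro: power2_le_imp_le)
  then show "\<mu> \<in> complex_of_real ` {1..}" by (metis atLeast_iff imageI)
next
  assume "\<mu> \<in> complex_of_real ` {1..}"
  then obtain x where x: "\<mu> = complex_of_real x" "1 \<le> x" by auto
  have "1 - \<mu>\<^sup>2 = complex_of_real (1 - x\<^sup>2)" using x by simp
  moreover have "1 - x\<^sup>2 \<le> 0" using x by simp
  ultimately show "Re (csqrt (1 - \<mu>\<^sup>2)) = 0"
    by (simp del: of_real_diff)
qed

text \<open>The minimum is over all complex \<omega>. Uniqueness is claimed off the ray from 1 only:
  on it the minimum is 1, which \<open>\<omega> = 0\<close> also attains. Both extremal \<beta>
  exist by compactness.\<close>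

theorem theorem2p2:
  fixes A :: "complex mat" and n :: nat and \<mu> \<omega>\<^sub>o\<^sub>p\<^sub>t :: complex and \<delta> :: real
  assumes "A \<in> carrier_mat n n"
    and "invertible_mat (diag_part A)"
    and "two_cyclic A"
    and "consistently_ordered A"
    and "Re \<mu> \<ge> 0"
    and "spectrum (jacobi_mat A) \<subseteq> {complex_of_real t * \<mu> | t. t \<in> {-1..1}}"
    and "\<mu> \<in> spectrum (jacobi_mat A)" and "- \<mu> \<in> spectrum (jacobi_mat A)"
    and "\<delta> = \<bar>Arg (\<mu> - 1)\<bar>"
    and "\<omega>\<^sub>o\<^sub>p\<^sub>t = 2 / (1 + csqrt (1 - \<mu>\<^sup>2))"
  shows "is_arg_min (\<lambda>\<omega>. spectral_radius (sor_mat A \<omega>)) (\<lambda>_. True) \<omega>\<^sub>o\<^sub>p\<^sub>t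
    \<and> (\<mu> \<notin> complex_of_real ` {1..} \<longrightarrow>
        (\<forall>\<omega>. is_arg_min (\<lambda>\<omega>. spectral_radius (sor_mat A \<omega>)) (\<lambda>_. True) \<omega> \<longrightarrow> \<omega> = \<omega>\<^sub>o\<^sub>p\<^sub>t))
    \<and> spectral_radius (sor_mat A \<omega>\<^sub>o\<^sub>p\<^sub>t) = cmod (1 - \<omega>\<^sub>o\<^sub>p\<^sub>t)
    \<and> (\<forall>R \<beta>\<^sub>m \<beta>\<^sub>M.
        0 < cmod (\<mu> - 1) \<and> cmod (\<mu> - 1) < R \<and>
        is_arg_min (\<lambda>\<beta>. sin (\<delta> / 2 + \<beta>)) (\<lambda>\<beta>. 0 \<le> \<beta> \<and> \<beta> \<le> 1 / 2 * arctan \<bar>Im \<mu>\<bar>) \<beta>\<^sub>m \<and>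
        is_arg_max (\<lambda>\<beta>. sin (\<delta> / 2 + \<beta>)) (\<lambda>\<beta>. 0 \<le> \<beta> \<and> \<beta> \<le> 1 / 2 * arctan \<bar>Im \<mu>\<bar>) \<beta>\<^sub>M \<longrightarrow>
        2 * sqrt 2 * c_star R * sin (\<delta> / 2 + \<beta>\<^sub>m) * sqrt (cmod (1 - \<mu>))
          \<le> 1 - spectral_radius (sor_mat A \<omega>\<^sub>o\<^sub>p\<^sub>t) \<and>
        1 - spectral_radius (sor_mat A \<omega>\<^sub>o\<^sub>p\<^sub>t)
          \<le> 2 * sqrt 2 * sin (\<delta> / 2 + \<beta>\<^sub>M) * sqrt (cmod (1 - \<mu>)))
    \<and> (\<forall>R\<ge>0. c_star R > 0) \<and> strict_antimono_on {0..} c_star \<and> c_star 0 = 1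
    \<and> (\<mu> \<in> {z. Re z \<ge> 0} - complex_of_real ` {1..} \<longrightarrow>
        spectral_radius (sor_mat A \<omega>\<^sub>o\<^sub>p\<^sub>t) < 1)
    \<and> (\<mu> \<in> complex_of_real ` {1..} \<longrightarrow> spectral_radius (sor_mat A \<omega>\<^sub>o\<^sub>p\<^sub>t) = 1)"
proof -
  note A = assms(1) and co = assms(4) and re = assms(5) and sub = assms(6) and \<mu> = assms(7)
  define \<rho> where "\<rho> \<omega> = spectral_radius (sor_mat A \<omega>)" for \<omega>
  have d: "det (diag_part A) \<noteq> 0" using det_diag_part_nonzero[OF A assms(2)] .
  have "jacobi_mat A \<in> carrier_mat n n"
    using mat_inv_mult(1)[OF part_carrier(1)[OF A] d] part_carrier[OF A] unfolding jacobi_mat_def by auto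
  \<comment> \<open>An eigenvalue excludes the empty matrix, whose spectral radius would be a
    maximum over the empty set.\<close>
  then have n: "n > 0"
    using \<mu> by (auto simp: spectrum_def intro: eigenvalue_imp_nonzero_dim)
  define q where "q = csqrt (1 - \<mu>\<^sup>2)"
  have q: "Re q \<ge> 0" "q\<^sup>2 = 1 - \<mu>\<^sup>2" by (simp_all add: q_def Re_csqrt del: csqrt.simps)
  have q1: "1 + q \<noteq> 0" using q(1) by (auto simp: complex_eq_iff)
  \<comment> \<open>For nonzero \<mu> this is \<open>(1 - q) / \<mu>\<close>; the chosen form also
    covers \<open>\<mu> = 0\<close>.\<close>
  define s\<^sub>0 where "s\<^sub>0 = \<mu> / (1 + q)"
  have \<omega>: "\<omega>\<^sub>o\<^sub>p\<^sub>t = 2 / (1 + q)" by (simp add: assms(10) q_def)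
  have "s\<^sub>0\<^sup>2 = (1 - q\<^sup>2) / (1 + q)\<^sup>2" by (simp add: s\<^sub>0_def power_divide q(2))
  also have "\<dots> = ((1 - q) * (1 + q)) / ((1 + q) * (1 + q))"
    by (simp add: power2_eq_square algebra_simps)
  also have "\<dots> = (1 - q) / (1 + q)" using q1 by simp
  finally have sq: "s\<^sub>0\<^sup>2 = (1 - q) / (1 + q)" .
  have \<omega>s: "\<omega>\<^sub>o\<^sub>p\<^sub>t = 1 + s\<^sub>0\<^sup>2" using q1 by (simp add: \<omega> sq field_simps)
  have s0: "2 * s\<^sub>0 = \<mu> * (1 + s\<^sub>0\<^sup>2)" unfolding \<omega>s[symmetric] by (simp add: \<omega> s\<^sub>0_def)
  have ne: "1 + s\<^sub>0\<^sup>2 \<noteq> 0" unfolding \<omega>s[symmetric] \<omega> using q1 by simp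
  have rad: "\<rho> \<omega>\<^sub>o\<^sub>p\<^sub>t = (cmod s\<^sub>0)\<^sup>2"
    unfolding \<rho>_def \<omega>s by (rule spectral_radius_sor_opt[OF A n d co \<mu> sub s0 ne])
  have ratio: "(cmod s\<^sub>0)\<^sup>2 = cmod (1 - q) / cmod (1 + q)"
    by (simp add: sq norm_divide flip: norm_power)
  define c where "c = cmod (1 + q) * (cmod (1 + q) + cmod (1 - q))"
  have c: "c > 0" unfolding c_def using q1 by (intro mult_pos_pos add_pos_nonneg) auto
  have gap: "1 - (cmod s\<^sub>0)\<^sup>2 = 4 * Re q / c"
    unfolding ratio c_def by (rule one_minus_norm_ratio[OF q(1)])
  have "4 * Re q / c \<ge> 0" using q(1) c by simp
  then have le1: "(cmod s\<^sub>0)\<^sup>2 \<le> 1" using gap by linarith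
  have less1: "(cmod s\<^sub>0)\<^sup>2 < 1" if "\<mu> \<notin> complex_of_real ` {1..}"
  proof -
    have "Re q > 0" using that Re_csqrt_one_minus_square_eq_0_iff[OF re] q(1)
      unfolding q_def by (metis le_less)
    then have "4 * Re q / c > 0" using c by simp
    then show ?thesis using gap by linarith
  qed
  have eq1: "(cmod s\<^sub>0)\<^sup>2 = 1" if "\<mu> \<in> complex_of_real ` {1..}"
    using that Re_csqrt_one_minus_square_eq_0_iff[OF re] gap by (simp add: q_def del: csqrt.simps)
  have pair: "\<exists>s t. s + t = \<mu> * (1 + s * t) \<and> \<omega>' = 1 + s * t \<and> (cmod s)\<^sup>2 \<le> \<rho> \<omega>' \<and> (cmod t)\<^sup>2 \<le> \<rho> \<omega>'" for \<omega>'
    unfolding \<rho>_def using sor_root_pair[OF A n d co \<mu>, of \<omega>'] by metis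
  have cm: "cmod s\<^sub>0 \<le> 1" using le1 by (simp add: abs_square_le_1)
  have minimal: "(cmod s\<^sub>0)\<^sup>2 \<le> \<rho> \<omega>'" for \<omega>'
  proof (rule ccontr)
    assume less: "\<not> ?thesis"
    obtain s t where st: "s + t = \<mu> * (1 + s * t)" "(cmod s)\<^sup>2 \<le> \<rho> \<omega>'" "(cmod t)\<^sup>2 \<le> \<rho> \<omega>'"
      using pair by blast
    then have "(cmod s)\<^sup>2 < (cmod s\<^sub>0)\<^sup>2" "(cmod t)\<^sup>2 < (cmod s\<^sub>0)\<^sup>2" using less by linarith+
    then have "cmod s < cmod s\<^sub>0" "cmod t < cmod s\<^sub>0" by (auto intro: power2_less_imp_less)
    then show False using double_root_minimal[OF s0 cm st(1)] by simp
  qed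
  have unique: "\<omega>' = \<omega>\<^sub>o\<^sub>p\<^sub>t" if "\<mu> \<notin> complex_of_real ` {1..}" "\<rho> \<omega>' \<le> (cmod s\<^sub>0)\<^sup>2" for \<omega>'
  proof -
    obtain s t where st: "s + t = \<mu> * (1 + s * t)" "\<omega>' = 1 + s * t"
        "(cmod s)\<^sup>2 \<le> \<rho> \<omega>'" "(cmod t)\<^sup>2 \<le> \<rho> \<omega>'"
      using pair by blast
    then have "(cmod s)\<^sup>2 \<le> (cmod s\<^sub>0)\<^sup>2" "(cmod t)\<^sup>2 \<le> (cmod s\<^sub>0)\<^sup>2" using that(2) by linarith+
    then have "cmod s \<le> cmod s\<^sub>0" "cmod t \<le> cmod s\<^sub>0" by (auto intro: power2_le_imp_le)
    moreover have "cmod s\<^sub>0 < 1" using less1[OF that(1)] by (simp add: abs_square_less_1)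
    ultimately show ?thesis
      using double_root_minimal[OF s0 cm st(1)] st(2) by (simp add: \<omega>s power2_eq_square)
  qed
  have bounds: "2 * sqrt 2 * c_star R * sin (\<delta> / 2 + \<beta>\<^sub>m) * sqrt (cmod (1 - \<mu>)) \<le> 1 - (cmod s\<^sub>0)\<^sup>2
      \<and> 1 - (cmod s\<^sub>0)\<^sup>2 \<le> 2 * sqrt 2 * sin (\<delta> / 2 + \<beta>\<^sub>M) * sqrt (cmod (1 - \<mu>))"
    if "0 < cmod (\<mu> - 1)" and R: "cmod (\<mu> - 1) < R"
      and m: "is_arg_min (\<lambda>\<beta>. sin (\<delta> / 2 + \<beta>)) (\<lambda>\<beta>. 0 \<le> \<beta> \<and> \<beta> \<le> 1 / 2 * arctan \<bar>Im \<mu>\<bar>) \<beta>\<^sub>m"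
      and M: "is_arg_max (\<lambda>\<beta>. sin (\<delta> / 2 + \<beta>)) (\<lambda>\<beta>. 0 \<le> \<beta> \<and> \<beta> \<le> 1 / 2 * arctan \<bar>Im \<mu>\<bar>) \<beta>\<^sub>M"
    for R \<beta>\<^sub>m \<beta>\<^sub>M
  proof -
    define S where "S = sin (\<delta> / 2 + arctan (\<bar>Im \<mu>\<bar> / (1 + Re \<mu>)) / 2)"
    define w where "w = sqrt (cmod (\<mu> - 1))"
    have ne1: "\<mu> \<noteq> 1" using that(1) by auto
    note half = Re_csqrt_half_angle[OF re ne1]
    \<comment> \<open>\<open>S\<close> is the value of the sine at an admissible \<beta>, hence lies
      between its extrema.\<close>
    have S: "S \<ge> 0" "sin (\<delta> / 2 + \<beta>\<^sub>m) \<le> S" "S \<le> sin (\<delta> / 2 + \<beta>\<^sub>M)"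
      using half(2-4) m M by (auto simp: S_def assms(9) is_arg_min_def is_arg_max_def not_less)
    have w: "w \<ge> 0" "sqrt (cmod (1 - \<mu>)) = w" by (simp_all add: w_def norm_minus_commute)
    have cs: "0 < c_star R" "c_star R \<le> c_star (cmod (\<mu> - 1))"
      using R c_star_pos[of R] monotone_onD[OF c_star_strict_antimono, of "cmod (\<mu> - 1)" R]
        norm_ge_zero[of "\<mu> - 1"] by (auto simp: less_imp_le)
    have "c_star R * sin (\<delta> / 2 + \<beta>\<^sub>m) \<le> c_star R * S" using cs S by simp
    also have "\<dots> \<le> c_star (cmod (\<mu> - 1)) * S" using cs S by (intro mult_right_mono)
    finally have "2 * sqrt 2 * w * (c_star R * sin (\<delta> / 2 + \<beta>\<^sub>m)) \<le> 2 * sqrt 2 * w * (c_star (cmod (\<mu> - 1)) * S)"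
      using w by (intro mult_left_mono) auto
    moreover have "2 * sqrt 2 * w * S \<le> 2 * sqrt 2 * w * sin (\<delta> / 2 + \<beta>\<^sub>M)"
      using w S by (intro mult_left_mono) auto
    moreover have "2 * sqrt 2 * c_star (cmod (\<mu> - 1)) * S * w \<le> 1 - (cmod s\<^sub>0)\<^sup>2"
        "1 - (cmod s\<^sub>0)\<^sup>2 \<le> 2 * sqrt 2 * S * w"
      using sor_radius_bounds[OF re ne1] by (simp_all add: ratio q_def S_def w_def assms(9) del: csqrt.simps)
    ultimately show ?thesis unfolding w(2) by (simp only: mult_ac) linarith
  qed
  have cm_\<omega>: "(cmod s\<^sub>0)\<^sup>2 = cmod (1 - \<omega>\<^sub>o\<^sub>p\<^sub>t)" by (simp add: \<omega>s norm_power)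
  have arg_min: "is_arg_min \<rho> (\<lambda>_. True) \<omega>\<^sub>o\<^sub>p\<^sub>t"
    using minimal by (simp add: is_arg_min_def rad not_less)
  have arg_min_unique: "\<omega>' = \<omega>\<^sub>o\<^sub>p\<^sub>t"
    if "\<mu> \<notin> complex_of_real ` {1..}" "is_arg_min \<rho> (\<lambda>_. True) \<omega>'" for \<omega>'
    using that(2) by (intro unique[OF that(1)]) (simp add: is_arg_min_def not_less flip: rad)
  show ?thesis
    unfolding \<rho>_def[symmetric] rad
  proof (intro conjI allI impI; (elim conjE)?)
    show "is_arg_min \<rho> (\<lambda>_. True) \<omega>\<^sub>o\<^sub>p\<^sub>t" by (rule arg_min)
  qed (use arg_min_unique cm_\<omega> bounds c_star_pos c_star_strict_antimono c_star_0 less1 eq1 in blast)+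
qed

end
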